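(* Let $(\omega_1,\omega_2,\omega_3)$ be a hypersymplectic or a para-hypersymplectic structure on a Lie algebroid $(A,\rho,[\cdot,\cdot])$ over $M$. Then the morphism $g^\flat:=\varepsilon_3\varepsilon_2\,\omega_3^\flat\circ\pi_1^\sharp\circ\omega_2^\flat:A\to A^*$ is a pseudo-metric on $A$.
   Context: For a $2$-form $\omega\in\Gamma(\bigwedge^2A^* )$, $\langle\omega^\flat(X),Y\rangle=\omega(X,Y)$; for a bivector $\pi\in\Gamma(\bigwedge^2A)$, $\langle\beta,\pi^\sharp(\alpha)\rangle=\pi(\alpha,\beta)$. A symplectic form is a closed (for the Lie algebroid differential) non-degenerate $2$-form; its inverse Poisson bivector $\pi$ satisfies $\omega^\flat\circ\pi^\sharp=\mathrm{Id}_{A^*}$, $\pi^\sharp\circ\omega^\flat=\mathrm{Id}_A$. All indices are in $\mathbb{Z}_3=\{1,2,3\}$. Given symplectic forms $\omega_1,\omega_2,\omega_3$ with inverses $\pi_1,\pi_2,\pi_3$, the transition tensors are $N_i:=\pi_{i-1}^\sharp\circ\omega_{i+1}^\flat$. The triple is an $\boldsymbol\varepsilon$-hypersymplectic structure, $\boldsymbol\varepsilon=(\varepsilon_1,\varepsilon_2,\varepsilon_3)$ with $\varepsilon_i=\pm1$, if $N_i^2=\varepsilon_i\mathrm{Id}_A$ for $i=1,2,3$. An $\boldsymbol\varepsilon$-hypersymplectic structure with $\varepsilon_1\varepsilon_2\varepsilon_3=-1$ is called hypersymplectic if $\varepsilon_1=\varepsilon_2=\varepsilon_3=-1$ and para-hypersymplectic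 otherwise (in the latter case, by convention, the indices are cyclically permuted so that $\varepsilon_1=\varepsilon_2=1$, $\varepsilon_3=-1$). A pseudo-metric on $A$ is a symmetric and non-degenerate $C^\infty(M)$-linear map $\Gamma(A)\to\Gamma(A^* )$. *)

theory Defs
  imports "HOL-Analysis.Analysis"
begin

section \<open>Smooth maps and smooth manifolds\<close>

text \<open>Used for open \<open>S\<close> in a finite-dimensional space only; there, all directional derivatives
  being $C^k$ is the same as the derivative being $C^k$.\<close>

fun C_k_on :: "nat \<Rightarrow> 'e::real_normed_vector set \<Rightarrow> ('e \<Rightarrow> 'f::real_normed_vector) \<Rightarrow> bool" where
  "C_k_on 0 S f \<longleftrightarrow> continuous_on S f"
| "C_k_on (Suc k) S f \<longleftrightarrow> (\<forall>x\<in>S. f differentiable (at x)) \<and>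
     (\<forall>v. C_k_on k S (\<lambda>x. frechet_derivative f (at x) v))"

definition smooth_on :: "'e::real_normed_vector set \<Rightarrow> ('e \<Rightarrow> 'f::real_normed_vector) \<Rightarrow> bool" where
  "smooth_on S f \<longleftrightarrow> (\<forall>k. C_k_on k S f)"

text \<open>The manifold is the whole type \<open>'m\<close>, with an atlas of charts $(U,\varphi)$.  The model space
  is a finite-dimensional normed space rather than a \<^class>\<open>euclidean_space\<close>, because the latter
  excludes dimension 0 (a Lie algebra is a Lie algebroid over a point).\<close>

type_synonym ('m, 'e) chart = "'m set \<times> ('m \<Rightarrow> 'e)"

definition smooth_manifold ::
    "('m::{t2_space, second_countable_topology}, 'e::real_normed_vector) chart set \<Rightarrow> bool" where
  "smooth_manifold \<A> \<longleftrightarrow>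
     (\<exists>B::'e set. finite B \<and> span B = UNIV) \<and>
     (\<Union>(U, \<phi>)\<in>\<A>. U) = UNIV \<and>
     (\<forall>(U, \<phi>)\<in>\<A>. open U \<and> open (\<phi> ` U) \<and> homeomorphism U (\<phi> ` U) \<phi> (inv_into U \<phi>)) \<and>
     (\<forall>(U, \<phi>)\<in>\<A>. \<forall>(V, \<psi>)\<in>\<A>. smooth_on (\<phi> ` (U \<inter> V)) (\<psi> \<circ> inv_into U \<phi>))"

definition smooth_fun_on ::
    "('m, 'e::real_normed_vector) chart set \<Rightarrow> 'm set \<Rightarrow> ('m \<Rightarrow> real) \<Rightarrow> bool" where
  "smooth_fun_on \<A> W f \<longleftrightarrow>
     (\<forall>(U, \<phi>)\<in>\<A>. smooth_on (\<phi> ` (U \<inter> W)) (f \<circ> inv_into U \<phi>))"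

definition smooth_functions :: "('m, 'e::real_normed_vector) chart set \<Rightarrow> ('m \<Rightarrow> real) set" where
  "smooth_functions \<A> = {f. smooth_fun_on \<A> UNIV f}"

text \<open>$T_xM$ as the derivations of $C^\infty(M)$ at \<open>x\<close>.  A derivation is extended by 0 to
  non-smooth functions, so that it is determined by its values on $C^\infty(M)$.\<close>

definition tangent_space ::
    "('m, 'e::real_normed_vector) chart set \<Rightarrow> 'm \<Rightarrow> (('m \<Rightarrow> real) \<Rightarrow> real) set" where
  "tangent_space \<A> x = {D.
     (\<forall>f\<in>smooth_functions \<A>. \<forall>h\<in>smooth_functions \<A>. D (\<lambda>y. f y + h y) = D f + D h) \<and>
     (\<forall>c. \<forall>f\<in>smooth_functions \<A>. D (\<lambda>y. c * f y) = c * D f) \<and>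
     (\<forall>f\<in>smooth_functions \<A>. \<forall>h\<in>smooth_functions \<A>.
        D (\<lambda>y. f y * h y) = D f * h x + f x * D h) \<and>
     (\<forall>f. f \<notin> smooth_functions \<A> \<longrightarrow> D f = 0)}"

section \<open>Vector bundles\<close>

text \<open>The fibre over \<open>x\<close> is a linear subspace of some fixed real vector space \<open>'v\<close>; this is no
  restriction, and the topology or position of the fibres in \<open>'v\<close> plays no role.  The smooth
  structure is given by local trivialisations, presented as local frames $(U, e)$: the
  trivialisation is $U \times \mathbb{R}^r \to A|_U$, $(x,t) \mapsto \sum_{i<r} t_i\, e_i(x)$.\<close>

record ('m, 'e, 'v) vbundle =
  atlas :: "('m, 'e) chart set"
  rank :: nat
  fibre :: "'m \<Rightarrow> 'v set"
  frames :: "('m set \<times> (nat \<Rightarrow> 'm \<Rightarrow> 'v)) set"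

definition smooth_combination_on ::
    "('m, 'e::real_normed_vector, 'v::real_vector, 'z) vbundle_scheme \<Rightarrow> (nat \<Rightarrow> 'm \<Rightarrow> 'v) \<Rightarrow> 'm set \<Rightarrow>
     ('m \<Rightarrow> 'v) \<Rightarrow> bool" where
  "smooth_combination_on A e W s \<longleftrightarrow>
     (\<exists>c. (\<forall>i<rank A. smooth_fun_on (atlas A) W (c i)) \<and>
          (\<forall>x\<in>W. s x = (\<Sum>i<rank A. c i x *\<^sub>R e i x)))"

definition vector_bundle ::
    "('m::{t2_space, second_countable_topology}, 'e::real_normed_vector, 'v::real_vector, 'z)
       vbundle_scheme \<Rightarrow> bool" where
  "vector_bundle A \<longleftrightarrow>
     smooth_manifold (atlas A) \<and>
     (\<Union>(U, e)\<in>frames A. U) = UNIV \<and>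
     (\<forall>(U, e)\<in>frames A. open U \<and>
        (\<forall>x\<in>U. inj_on (\<lambda>i. e i x) {..<rank A} \<and>
               independent ((\<lambda>i. e i x) ` {..<rank A}) \<and>
               span ((\<lambda>i. e i x) ` {..<rank A}) = fibre A x)) \<and>
     (\<forall>(U, e)\<in>frames A. \<forall>(V, e')\<in>frames A. \<forall>j<rank A.
        smooth_combination_on A e (U \<inter> V) (e' j))"

definition sections ::
    "('m, 'e::real_normed_vector, 'v::real_vector, 'z) vbundle_scheme \<Rightarrow> ('m \<Rightarrow> 'v) set" where
  "sections A = {s. (\<forall>x. s x \<in> fibre A x) \<and>
     (\<forall>(U, e)\<in>frames A. smooth_combination_on A e U s)}"

text \<open>Covectors at \<open>x\<close>: linear functionals on the fibre, extended by 0 outside the fibre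
  so that equality of functionals is equality on the fibre.\<close>

definition dual_fibre ::
    "('m, 'e::real_normed_vector, 'v::real_vector, 'z) vbundle_scheme \<Rightarrow> 'm \<Rightarrow> ('v \<Rightarrow> real) set" where
  "dual_fibre A x = {\<alpha>.
     (\<forall>v\<in>fibre A x. \<forall>w\<in>fibre A x. \<alpha> (v + w) = \<alpha> v + \<alpha> w) \<and>
     (\<forall>c. \<forall>v\<in>fibre A x. \<alpha> (c *\<^sub>R v) = c * \<alpha> v) \<and>
     (\<forall>v. v \<notin> fibre A x \<longrightarrow> \<alpha> v = 0)}"

definition dual_sections ::
    "('m, 'e::real_normed_vector, 'v::real_vector, 'z) vbundle_scheme \<Rightarrow> ('m \<Rightarrow> 'v \<Rightarrow> real) set" where
  "dual_sections A = {\<alpha>. (\<forall>x. \<alpha> x \<in> dual_fibre A x) \<and>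
     (\<forall>(U, e)\<in>frames A. \<forall>i<rank A. smooth_fun_on (atlas A) U (\<lambda>x. \<alpha> x (e i x)))}"

section \<open>2-forms and bivectors\<close>

definition two_form ::
    "('m, 'e::real_normed_vector, 'v::real_vector, 'z) vbundle_scheme \<Rightarrow>
     ('m \<Rightarrow> 'v \<Rightarrow> 'v \<Rightarrow> real) \<Rightarrow> bool" where
  "two_form A \<omega> \<longleftrightarrow>
     (\<forall>x. \<forall>u\<in>fibre A x. \<forall>v\<in>fibre A x. \<forall>w\<in>fibre A x. \<omega> x (u + v) w = \<omega> x u w + \<omega> x v w) \<and>
     (\<forall>x c. \<forall>u\<in>fibre A x. \<forall>w\<in>fibre A x. \<omega> x (c *\<^sub>R u) w = c * \<omega> x u w) \<and>
     (\<forall>x. \<forall>u\<in>fibre A x. \<forall>w\<in>fibre A x. \<omega> x u w = - \<omega> x w u) \<and>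
     (\<forall>(U, e)\<in>frames A. \<forall>i<rank A. \<forall>j<rank A.
        smooth_fun_on (atlas A) U (\<lambda>x. \<omega> x (e i x) (e j x)))"

text \<open>Smoothness of a bivector field: $\pi = \sum_{i,j} c_{ij}\, e_i \otimes e_j$ with smooth
  $c_{ij}$ in every local frame.\<close>

definition bivector ::
    "('m, 'e::real_normed_vector, 'v::real_vector, 'z) vbundle_scheme \<Rightarrow>
     ('m \<Rightarrow> ('v \<Rightarrow> real) \<Rightarrow> ('v \<Rightarrow> real) \<Rightarrow> real) \<Rightarrow> bool" where
  "bivector A \<pi> \<longleftrightarrow>
     (\<forall>x. \<forall>\<alpha>\<in>dual_fibre A x. \<forall>\<beta>\<in>dual_fibre A x. \<forall>\<gamma>\<in>dual_fibre A x.
        \<pi> x (\<lambda>v. \<alpha> v + \<beta> v) \<gamma> = \<pi> x \<alpha> \<gamma> + \<pi> x \<beta> \<gamma>) \<and>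
     (\<forall>x c. \<forall>\<alpha>\<in>dual_fibre A x. \<forall>\<gamma>\<in>dual_fibre A x. \<pi> x (\<lambda>v. c * \<alpha> v) \<gamma> = c * \<pi> x \<alpha> \<gamma>) \<and>
     (\<forall>x. \<forall>\<alpha>\<in>dual_fibre A x. \<forall>\<gamma>\<in>dual_fibre A x. \<pi> x \<alpha> \<gamma> = - \<pi> x \<gamma> \<alpha>) \<and>
     (\<forall>(U, e)\<in>frames A. \<exists>c.
        (\<forall>i<rank A. \<forall>j<rank A. smooth_fun_on (atlas A) U (c i j)) \<and>
        (\<forall>x\<in>U. \<forall>\<alpha>\<in>dual_fibre A x. \<forall>\<beta>\<in>dual_fibre A x.
           \<pi> x \<alpha> \<beta> = (\<Sum>i<rank A. \<Sum>j<rank A. c i j x * \<alpha> (e i x) * \<beta> (e j x))))"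

definition flat ::
    "('m, 'e::real_normed_vector, 'v::real_vector, 'z) vbundle_scheme \<Rightarrow>
     ('m \<Rightarrow> 'v \<Rightarrow> 'v \<Rightarrow> real) \<Rightarrow> 'm \<Rightarrow> 'v \<Rightarrow> ('v \<Rightarrow> real)" where
  "flat A \<omega> x v = (\<lambda>w. if w \<in> fibre A x then \<omega> x v w else 0)"

text \<open>$\langle\beta, \pi^\sharp(\alpha)\rangle = \pi(\alpha,\beta)$ for all \<open>\<beta>\<close>, which determines
  $\pi^\sharp(\alpha)$ because the fibre is finite-dimensional.\<close>

definition sharp ::
    "('m, 'e::real_normed_vector, 'v::real_vector, 'z) vbundle_scheme \<Rightarrow>
     ('m \<Rightarrow> ('v \<Rightarrow> real) \<Rightarrow> ('v \<Rightarrow> real) \<Rightarrow> real) \<Rightarrow> 'm \<Rightarrow> ('v \<Rightarrow> real) \<Rightarrow> 'v" where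
  "sharp A \<pi> x \<alpha> = (THE v. v \<in> fibre A x \<and> (\<forall>\<beta>\<in>dual_fibre A x. \<beta> v = \<pi> x \<alpha> \<beta>))"

text \<open>Non-degeneracy of a (skew-)symmetric bilinear form on the fibres, given as a map
  \<open>b\<close> from the fibres to their duals.\<close>

definition nondegenerate ::
    "('m, 'e::real_normed_vector, 'v::real_vector, 'z) vbundle_scheme \<Rightarrow>
     ('m \<Rightarrow> 'v \<Rightarrow> ('v \<Rightarrow> real)) \<Rightarrow> bool" where
  "nondegenerate A b \<longleftrightarrow>
     (\<forall>x. \<forall>v\<in>fibre A x. (\<forall>w\<in>fibre A x. b x v w = 0) \<longrightarrow> v = 0)"

section \<open>Lie algebroids\<close>

record ('m, 'e, 'v) lie_algebroid = "('m, 'e, 'v) vbundle" +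
  anchor :: "'m \<Rightarrow> 'v \<Rightarrow> (('m \<Rightarrow> real) \<Rightarrow> real)"
  bracket :: "('m \<Rightarrow> 'v) \<Rightarrow> ('m \<Rightarrow> 'v) \<Rightarrow> ('m \<Rightarrow> 'v)"

text \<open>The function $\rho(X)(f)$.\<close>

definition anchor_deriv ::
    "('m, 'e::real_normed_vector, 'v::real_vector, 'z) lie_algebroid_scheme \<Rightarrow>
     ('m \<Rightarrow> 'v) \<Rightarrow> ('m \<Rightarrow> real) \<Rightarrow> ('m \<Rightarrow> real)" where
  "anchor_deriv A X f = (\<lambda>x. anchor A x (X x) f)"

text \<open>The anchor is a smooth bundle map $A \to TM$: it is fibrewise linear and sends smooth
  sections to smooth vector fields, i.e. those mapping smooth functions to smooth functions.\<close>

definition anchor_map ::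
    "('m, 'e::real_normed_vector, 'v::real_vector, 'z) lie_algebroid_scheme \<Rightarrow> bool" where
  "anchor_map A \<longleftrightarrow>
     (\<forall>x. \<forall>v\<in>fibre A x. anchor A x v \<in> tangent_space (atlas A) x) \<and>
     (\<forall>x. \<forall>v\<in>fibre A x. \<forall>w\<in>fibre A x. \<forall>f.
        anchor A x (v + w) f = anchor A x v f + anchor A x w f) \<and>
     (\<forall>x c. \<forall>v\<in>fibre A x. \<forall>f. anchor A x (c *\<^sub>R v) f = c * anchor A x v f) \<and>
     (\<forall>X\<in>sections A. \<forall>f\<in>smooth_functions (atlas A).
        anchor_deriv A X f \<in> smooth_functions (atlas A))"

text \<open>Linearity, the Jacobi identity and the Leibniz rule in the second argument suffice, in
  view of skew-symmetry; \<open>anchor\<close> preserving brackets is a consequence of the axioms.\<close>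

definition lie_algebroid ::
    "('m::{t2_space, second_countable_topology}, 'e::real_normed_vector, 'v::real_vector, 'z)
       lie_algebroid_scheme \<Rightarrow> bool" where
  "lie_algebroid A \<longleftrightarrow>
     vector_bundle A \<and> anchor_map A \<and>
     (\<forall>X\<in>sections A. \<forall>Y\<in>sections A. bracket A X Y \<in> sections A) \<and>
     (\<forall>X\<in>sections A. \<forall>Y\<in>sections A. \<forall>Z\<in>sections A.
        bracket A X (\<lambda>x. Y x + Z x) = (\<lambda>x. bracket A X Y x + bracket A X Z x)) \<and>
     (\<forall>c. \<forall>X\<in>sections A. \<forall>Y\<in>sections A.
        bracket A X (\<lambda>x. c *\<^sub>R Y x) = (\<lambda>x. c *\<^sub>R bracket A X Y x)) \<and>
     (\<forall>X\<in>sections A. \<forall>Y\<in>sections A. bracket A X Y = (\<lambda>x. - bracket A Y X x)) \<and>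
     (\<forall>X\<in>sections A. \<forall>Y\<in>sections A. \<forall>Z\<in>sections A. \<forall>x.
        bracket A X (bracket A Y Z) x + bracket A Y (bracket A Z X) x
          + bracket A Z (bracket A X Y) x = 0) \<and>
     (\<forall>X\<in>sections A. \<forall>Y\<in>sections A. \<forall>f\<in>smooth_functions (atlas A).
        bracket A X (\<lambda>x. f x *\<^sub>R Y x) =
          (\<lambda>x. f x *\<^sub>R bracket A X Y x + anchor_deriv A X f x *\<^sub>R Y x))"

text \<open>The Lie algebroid differential of a 2-form.\<close>

definition d_two_form ::
    "('m, 'e::real_normed_vector, 'v::real_vector, 'z) lie_algebroid_scheme \<Rightarrow>
     ('m \<Rightarrow> 'v \<Rightarrow> 'v \<Rightarrow> real) \<Rightarrow> ('m \<Rightarrow> 'v) \<Rightarrow> ('m \<Rightarrow> 'v) \<Rightarrow> ('m \<Rightarrow> 'v) \<Rightarrow> ('m \<Rightarrow> real)" where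
  "d_two_form A \<omega> X Y Z = (\<lambda>x.
     anchor_deriv A X (\<lambda>y. \<omega> y (Y y) (Z y)) x
     - anchor_deriv A Y (\<lambda>y. \<omega> y (X y) (Z y)) x
     + anchor_deriv A Z (\<lambda>y. \<omega> y (X y) (Y y)) x
     - \<omega> x (bracket A X Y x) (Z x)
     + \<omega> x (bracket A X Z x) (Y x)
     - \<omega> x (bracket A Y Z x) (X x))"

definition symplectic ::
    "('m, 'e::real_normed_vector, 'v::real_vector, 'z) lie_algebroid_scheme \<Rightarrow>
     ('m \<Rightarrow> 'v \<Rightarrow> 'v \<Rightarrow> real) \<Rightarrow> bool" where
  "symplectic A \<omega> \<longleftrightarrow>
     two_form A \<omega> \<and> nondegenerate A (flat A \<omega>) \<and>
     (\<forall>X\<in>sections A. \<forall>Y\<in>sections A. \<forall>Z\<in>sections A. \<forall>x. d_two_form A \<omega> X Y Z x = 0)"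

text \<open>For a symplectic form, \<open>\<pi>\<close> being Poisson is a consequence of these conditions.\<close>

definition inverse_bivector ::
    "('m, 'e::real_normed_vector, 'v::real_vector, 'z) vbundle_scheme \<Rightarrow>
     ('m \<Rightarrow> 'v \<Rightarrow> 'v \<Rightarrow> real) \<Rightarrow> ('m \<Rightarrow> ('v \<Rightarrow> real) \<Rightarrow> ('v \<Rightarrow> real) \<Rightarrow> real) \<Rightarrow> bool" where
  "inverse_bivector A \<omega> \<pi> \<longleftrightarrow>
     bivector A \<pi> \<and>
     (\<forall>x. \<forall>\<alpha>\<in>dual_fibre A x. flat A \<omega> x (sharp A \<pi> x \<alpha>) = \<alpha>) \<and>
     (\<forall>x. \<forall>v\<in>fibre A x. sharp A \<pi> x (flat A \<omega> x v) = v)"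

section \<open>Hypersymplectic structures\<close>

text \<open>Indices range over the type \<open>3\<close> of integers modulo 3, whose elements are 1, 2 and 3 = 0.\<close>

definition transition_tensor ::
    "('m, 'e::real_normed_vector, 'v::real_vector, 'z) vbundle_scheme \<Rightarrow>
     (3 \<Rightarrow> 'm \<Rightarrow> 'v \<Rightarrow> 'v \<Rightarrow> real) \<Rightarrow> (3 \<Rightarrow> 'm \<Rightarrow> ('v \<Rightarrow> real) \<Rightarrow> ('v \<Rightarrow> real) \<Rightarrow> real) \<Rightarrow>
     3 \<Rightarrow> 'm \<Rightarrow> 'v \<Rightarrow> 'v" where
  "transition_tensor A \<omega> \<pi> i x v = sharp A (\<pi> (i - 1)) x (flat A (\<omega> (i + 1)) x v)"

definition eps_hypersymplectic ::
    "('m, 'e::real_normed_vector, 'v::real_vector, 'z) lie_algebroid_scheme \<Rightarrow> (3 \<Rightarrow> real) \<Rightarrow>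
     (3 \<Rightarrow> 'm \<Rightarrow> 'v \<Rightarrow> 'v \<Rightarrow> real) \<Rightarrow> (3 \<Rightarrow> 'm \<Rightarrow> ('v \<Rightarrow> real) \<Rightarrow> ('v \<Rightarrow> real) \<Rightarrow> real) \<Rightarrow> bool" where
  "eps_hypersymplectic A \<epsilon> \<omega> \<pi> \<longleftrightarrow>
     (\<forall>i. \<epsilon> i = 1 \<or> \<epsilon> i = -1) \<and>
     (\<forall>i. symplectic A (\<omega> i) \<and> inverse_bivector A (\<omega> i) (\<pi> i)) \<and>
     (\<forall>i x. \<forall>v\<in>fibre A x.
        transition_tensor A \<omega> \<pi> i x (transition_tensor A \<omega> \<pi> i x v) = \<epsilon> i *\<^sub>R v)"

definition hypersymplectic ::
    "('m, 'e::real_normed_vector, 'v::real_vector, 'z) lie_algebroid_scheme \<Rightarrow> (3 \<Rightarrow> real) \<Rightarrow>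
     (3 \<Rightarrow> 'm \<Rightarrow> 'v \<Rightarrow> 'v \<Rightarrow> real) \<Rightarrow> (3 \<Rightarrow> 'm \<Rightarrow> ('v \<Rightarrow> real) \<Rightarrow> ('v \<Rightarrow> real) \<Rightarrow> real) \<Rightarrow> bool" where
  "hypersymplectic A \<epsilon> \<omega> \<pi> \<longleftrightarrow>
     eps_hypersymplectic A \<epsilon> \<omega> \<pi> \<and> \<epsilon> 1 * \<epsilon> 2 * \<epsilon> 3 = -1 \<and>
     (\<epsilon> 1 = -1 \<and> \<epsilon> 2 = -1 \<and> \<epsilon> 3 = -1)"

text \<open>The indices are not normalised: besides \<open>\<epsilon> = (1, 1, -1)\<close>, the usual convention, its cyclic
  permutations are allowed.\<close>

definition para_hypersymplectic ::
    "('m, 'e::real_normed_vector, 'v::real_vector, 'z) lie_algebroid_scheme \<Rightarrow> (3 \<Rightarrow> real) \<Rightarrow>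
     (3 \<Rightarrow> 'm \<Rightarrow> 'v \<Rightarrow> 'v \<Rightarrow> real) \<Rightarrow> (3 \<Rightarrow> 'm \<Rightarrow> ('v \<Rightarrow> real) \<Rightarrow> ('v \<Rightarrow> real) \<Rightarrow> real) \<Rightarrow> bool" where
  "para_hypersymplectic A \<epsilon> \<omega> \<pi> \<longleftrightarrow>
     eps_hypersymplectic A \<epsilon> \<omega> \<pi> \<and> \<epsilon> 1 * \<epsilon> 2 * \<epsilon> 3 = -1 \<and>
     \<not> (\<epsilon> 1 = -1 \<and> \<epsilon> 2 = -1 \<and> \<epsilon> 3 = -1)"

section \<open>Pseudo-metrics\<close>

text \<open>The map on sections induced by a bundle map.\<close>

definition on_sections :: "('m \<Rightarrow> 'v \<Rightarrow> 'w) \<Rightarrow> ('m \<Rightarrow> 'v) \<Rightarrow> ('m \<Rightarrow> 'w)" where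
  "on_sections g X = (\<lambda>x. g x (X x))"

definition smooth_linear_to_dual ::
    "('m, 'e::real_normed_vector, 'v::real_vector, 'z) vbundle_scheme \<Rightarrow>
     (('m \<Rightarrow> 'v) \<Rightarrow> ('m \<Rightarrow> 'v \<Rightarrow> real)) \<Rightarrow> bool" where
  "smooth_linear_to_dual A G \<longleftrightarrow>
     (\<forall>X\<in>sections A. G X \<in> dual_sections A) \<and>
     (\<forall>X\<in>sections A. \<forall>Y\<in>sections A. G (\<lambda>x. X x + Y x) = (\<lambda>x v. G X x v + G Y x v)) \<and>
     (\<forall>f\<in>smooth_functions (atlas A). \<forall>X\<in>sections A.
        G (\<lambda>x. f x *\<^sub>R X x) = (\<lambda>x v. f x * G X x v))"

text \<open>A pseudo-metric, given by a bundle map $g : A \to A^*$: the induced map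
  $\Gamma(A) \to \Gamma(A^*)$ is $C^\infty(M)$-linear, and symmetry and non-degeneracy are required
  fibrewise.\<close>

definition pseudo_metric ::
    "('m, 'e::real_normed_vector, 'v::real_vector, 'z) vbundle_scheme \<Rightarrow>
     ('m \<Rightarrow> 'v \<Rightarrow> ('v \<Rightarrow> real)) \<Rightarrow> bool" where
  "pseudo_metric A g \<longleftrightarrow>
     (\<forall>x. \<forall>v\<in>fibre A x. g x v \<in> dual_fibre A x) \<and>
     (\<forall>x. \<forall>u\<in>fibre A x. \<forall>v\<in>fibre A x. g x (u + v) = (\<lambda>w. g x u w + g x v w)) \<and>
     (\<forall>x c. \<forall>v\<in>fibre A x. g x (c *\<^sub>R v) = (\<lambda>w. c * g x v w)) \<and>
     smooth_linear_to_dual A (on_sections g) \<and>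
     (\<forall>x. \<forall>v\<in>fibre A x. \<forall>w\<in>fibre A x. g x v w = g x w v) \<and>
     nondegenerate A g"

definition g_flat ::
    "('m, 'e::real_normed_vector, 'v::real_vector, 'z) vbundle_scheme \<Rightarrow> (3 \<Rightarrow> real) \<Rightarrow>
     (3 \<Rightarrow> 'm \<Rightarrow> 'v \<Rightarrow> 'v \<Rightarrow> real) \<Rightarrow> (3 \<Rightarrow> 'm \<Rightarrow> ('v \<Rightarrow> real) \<Rightarrow> ('v \<Rightarrow> real) \<Rightarrow> real) \<Rightarrow>
     'm \<Rightarrow> 'v \<Rightarrow> ('v \<Rightarrow> real)" where
  "g_flat A \<epsilon> \<omega> \<pi> x v =
     (\<lambda>w. \<epsilon> 3 * \<epsilon> 2 * flat A (\<omega> 3) x (sharp A (\<pi> 1) x (flat A (\<omega> 2) x v)) w)"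

end

theory Submission
  imports Defs
begin

text \<open>Write \<open>P i j\<close> for $\pi_i^\sharp \circ \omega_j^\flat$, so that
  \<open>P i j \<circ> P j k = P i k\<close> and the transition tensors are \<open>P 3 2\<close>, \<open>P 1 3\<close>, \<open>P 2 1\<close>.  The
  condition on the squares says \<open>P 3 2 = \<epsilon>\<^sub>1 P 2 3\<close> and its cyclic permutations, hence
  \<open>P 3 2 \<circ> P 1 3 = \<epsilon>\<^sub>1 \<epsilon>\<^sub>2 P 2 1 = \<epsilon>\<^sub>1 \<epsilon>\<^sub>2 \<epsilon>\<^sub>3 P 1 2 = - P 1 2\<close>.  Skew-symmetry of \<open>\<pi>\<^sub>1\<close> gives
  \<open>\<omega>\<^sub>3 (P 1 2 w, v) = - \<omega>\<^sub>2 (P 1 3 v, w) = - \<omega>\<^sub>3 (P 3 2 (P 1 3 v), w)\<close>, so the two combine to the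
  symmetry of the metric.\<close>

section \<open>Smooth functions\<close>

lemma frechet_derivative_cong_open:
  assumes "open S" "x \<in> S" "\<And>y. y \<in> S \<Longrightarrow> f y = g y" "f differentiable (at x)"
  shows "g differentiable (at x)" "frechet_derivative g (at x) = frechet_derivative f (at x)"
proof -
  have "(f has_derivative frechet_derivative f (at x)) (at x)"
    using assms(4) frechet_derivative_works by blast
  then have *: "(g has_derivative frechet_derivative f (at x)) (at x)"
    using assms(1-3) by (rule has_derivative_transform_within_open)
  then show "g differentiable (at x)"
    by (rule differentiableI)
  show "frechet_derivative g (at x) = frechet_derivative f (at x)"
    using frechet_derivative_at[OF *] by simp
qed

text \<open>The derivatives in \<open>C_k_on\<close> are taken at \<open>x\<close>, not within
  \<open>S\<close>; openness of \<open>S\<close> makes them depend on the values on \<open>S\<close>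
  alone. This allows \<open>frechet_derivative\<close> to be replaced by an explicit formula valid
  only on \<open>S\<close>, as the sum and product rules require.\<close>

lemma C_k_on_cong:
  assumes "open S" "\<And>x. x \<in> S \<Longrightarrow> f x = g x" "C_k_on k S f"
  shows "C_k_on k S g"
  using assms(2,3)
proof (induction k arbitrary: f g)
  case 0
  then show ?case
    by (simp cong: continuous_on_cong)
next
  case (Suc k)
  note d = frechet_derivative_cong_open[OF \<open>open S\<close> _ Suc.prems(1)]
  have "C_k_on k S (\<lambda>x. frechet_derivative g (at x) v)" for v
  proof (rule Suc.IH)
    show "frechet_derivative f (at x) v = frechet_derivative g (at x) v" if "x \<in> S" for x
      using d(2)[OF that] that Suc.prems(2) by simp
    show "C_k_on k S (\<lambda>x. frechet_derivative f (at x) v)"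
      using Suc.prems(2) by simp
  qed
  then show ?case
    using d(1) Suc.prems(2) by auto
qed

text \<open>The recursion never mentions order \<open>k\<close> of the function itself; the claim
  descends to the base case, where differentiability gives continuity. The product rule needs it
  because its formula has undifferentiated factors next to derivatives that are only C^k.\<close>

lemma C_k_on_Suc_imp: "C_k_on (Suc k) S f \<Longrightarrow> C_k_on k S f"
proof (induction k arbitrary: f)
  case 0
  then show ?case
    by (auto intro!: continuous_at_imp_continuous_on differentiable_imp_continuous_within)
next
  case (Suc k)
  have "C_k_on k S (\<lambda>x. frechet_derivative f (at x) v)" for v
    using Suc.prems by (intro Suc.IH) simp
  then show ?case
    using Suc.prems by simp
qed

lemma C_k_on_const: "C_k_on k S (\<lambda>x. c)"
  by (induction k arbitrary: c) (simp_all add: frechet_derivative_const)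

lemma C_k_on_add:
  assumes "open S" "C_k_on k S f" "C_k_on k S g"
  shows "C_k_on k S (\<lambda>x. f x + g x)"
  using assms(2,3)
proof (induction k arbitrary: f g)
  case 0
  then show ?case
    by (simp add: continuous_on_add)
next
  case (Suc k)
  have d: "((\<lambda>x. f x + g x) has_derivative
      (\<lambda>v. frechet_derivative f (at x) v + frechet_derivative g (at x) v)) (at x)" if "x \<in> S" for x
    using that Suc.prems by (intro has_derivative_add) (auto simp: frechet_derivative_works)
  have "C_k_on k S (\<lambda>x. frechet_derivative (\<lambda>x. f x + g x) (at x) v)" for v
  proof (rule C_k_on_cong[OF \<open>open S\<close>])
    show "C_k_on k S (\<lambda>x. frechet_derivative f (at x) v + frechet_derivative g (at x) v)"
      using Suc.prems by (intro Suc.IH) simp_all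
  qed (rule fun_cong[OF frechet_derivative_at[OF d]])
  then show ?case
    using d by (auto simp: differentiable_def)
qed

lemma C_k_on_mult:
  fixes f g :: "'e::real_normed_vector \<Rightarrow> 'a::real_normed_algebra"
  assumes "open S" "C_k_on k S f" "C_k_on k S g"
  shows "C_k_on k S (\<lambda>x. f x * g x)"
  using assms(2,3)
proof (induction k arbitrary: f g)
  case 0
  then show ?case
    by (simp add: continuous_on_mult)
next
  case (Suc k)
  have d: "((\<lambda>x. f x * g x) has_derivative
      (\<lambda>v. f x * frechet_derivative g (at x) v + frechet_derivative f (at x) v * g x)) (at x)"
    if "x \<in> S" for x
    using that Suc.prems by (intro has_derivative_mult) (auto simp: frechet_derivative_works)
  have "C_k_on k S (\<lambda>x. frechet_derivative (\<lambda>x. f x * g x) (at x) v)" for v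
  proof (rule C_k_on_cong[OF \<open>open S\<close>])
    show "C_k_on k S
        (\<lambda>x. f x * frechet_derivative g (at x) v + frechet_derivative f (at x) v * g x)"
      using Suc.prems C_k_on_Suc_imp[OF Suc.prems(1)] C_k_on_Suc_imp[OF Suc.prems(2)]
      by (intro C_k_on_add[OF \<open>open S\<close>] Suc.IH) simp_all
  qed (rule fun_cong[OF frechet_derivative_at[OF d]])
  then show ?case
    using d by (auto simp: differentiable_def)
qed

text \<open>A chart is a homeomorphism onto an open set, so relatively open images are open. This
  supplies the openness on which the calculus of \<open>C_k_on\<close> depends.\<close>

lemma open_chart_image:
  assumes "smooth_manifold \<A>" "(U, \<phi>) \<in> \<A>" "open W"
  shows "open (\<phi> ` (U \<inter> W))"
proof -
  have U: "open U" "open (\<phi> ` U)" "homeomorphism U (\<phi> ` U) \<phi> (inv_into U \<phi>)"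
    using assms(1,2) unfolding smooth_manifold_def by auto
  have "openin (top_of_set (\<phi> ` U)) (\<phi> ` (U \<inter> W))"
    using homeomorphism_imp_open_map[OF U(3)] assms(3) by (simp add: openin_open_Int)
  then show ?thesis
    using U(2) openin_open_trans by blast
qed

section \<open>Closure properties of smooth functions on an open subset of a manifold\<close>

context
  fixes \<A> :: "('m::{t2_space, second_countable_topology}, 'e::real_normed_vector) chart set"
    and W :: "'m set"
  assumes manifold: "smooth_manifold \<A>" and W: "open W"
begin

text \<open>On the chart image of \<open>U \<inter> W\<close> the map
  \<open>inv_into U \<phi>\<close> undoes \<open>\<phi>\<close> and so lands in \<open>W\<close>;
  the two functions therefore have the same coordinate expression there.\<close>

lemma smooth_fun_on_cong:
  assumes "\<And>x. x \<in> W \<Longrightarrow> f x = g x" "smooth_fun_on \<A> W f"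
  shows "smooth_fun_on \<A> W g"
  unfolding smooth_fun_on_def smooth_on_def
proof clarify
  fix U \<phi> k
  assume chart: "(U, \<phi>) \<in> \<A>"
  then have "homeomorphism U (\<phi> ` U) \<phi> (inv_into U \<phi>)"
    using manifold unfolding smooth_manifold_def by auto
  then have "(f \<circ> inv_into U \<phi>) y = (g \<circ> inv_into U \<phi>) y" if "y \<in> \<phi> ` (U \<inter> W)" for y
    using that assms(1) by (auto simp: homeomorphism_apply1)
  moreover have "C_k_on k (\<phi> ` (U \<inter> W)) (f \<circ> inv_into U \<phi>)"
    using assms(2) chart unfolding smooth_fun_on_def smooth_on_def by auto
  ultimately show "C_k_on k (\<phi> ` (U \<inter> W)) (g \<circ> inv_into U \<phi>)"
    by (rule C_k_on_cong[OF open_chart_image[OF manifold chart W]])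
qed

lemma smooth_fun_on_const: "smooth_fun_on \<A> W (\<lambda>x. c)"
  by (auto simp: smooth_fun_on_def smooth_on_def comp_def C_k_on_const)

lemma smooth_fun_on_add:
  "smooth_fun_on \<A> W f \<Longrightarrow> smooth_fun_on \<A> W g \<Longrightarrow> smooth_fun_on \<A> W (\<lambda>x. f x + g x)"
  unfolding smooth_fun_on_def smooth_on_def comp_def
  using C_k_on_add[OF open_chart_image[OF manifold _ W]] by fast

lemma smooth_fun_on_mult:
  "smooth_fun_on \<A> W f \<Longrightarrow> smooth_fun_on \<A> W g \<Longrightarrow> smooth_fun_on \<A> W (\<lambda>x. f x * g x)"
  unfolding smooth_fun_on_def smooth_on_def comp_def
  using C_k_on_mult[OF open_chart_image[OF manifold _ W]] by fast

lemma smooth_fun_on_sum: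
  "(\<And>i. i \<in> I \<Longrightarrow> smooth_fun_on \<A> W (f i)) \<Longrightarrow> smooth_fun_on \<A> W (\<lambda>x. \<Sum>i\<in>I. f i x)"
  \<comment> \<open>A sum over an infinite index set is 0 by convention, so this case and the empty
    one are both the constant function.\<close>
  by (induction I rule: infinite_finite_induct)
    (simp_all add: smooth_fun_on_const smooth_fun_on_add)

end

section \<open>Musical maps\<close>

context
  fixes A :: "('m::{t2_space, second_countable_topology}, 'e::real_normed_vector,
                'v::real_vector, 'z) vbundle_scheme"
  assumes vector_bundle: "vector_bundle A"
begin

lemma smooth_manifold_atlas: "smooth_manifold (atlas A)"
  using vector_bundle by (simp add: vector_bundle_def)

lemma frame_at:
  obtains U e where "(U, e) \<in> frames A" "x \<in> U"
proof -
  have "x \<in> (\<Union>(U, e)\<in>frames A. U)"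
    using vector_bundle unfolding vector_bundle_def by simp
  then show thesis
    using that by auto
qed

lemma
  assumes "(U, e) \<in> frames A"
  shows frame_open: "open U"
    and frame_independent: "x \<in> U \<Longrightarrow> independent ((\<lambda>i. e i x) ` {..<rank A})"
    and frame_span: "x \<in> U \<Longrightarrow> span ((\<lambda>i. e i x) ` {..<rank A}) = fibre A x"
  using vector_bundle assms unfolding vector_bundle_def by auto

lemma frame_mem:
  assumes "(U, e) \<in> frames A" "x \<in> U" "i < rank A"
  shows "e i x \<in> fibre A x"
  using span_superset[of "(\<lambda>i. e i x) ` {..<rank A}"] assms(3) frame_span[OF assms(1,2)] by auto

lemma subspace_fibre: "subspace (fibre A x)"
proof -
  obtain U e where "(U, e) \<in> frames A" "x \<in> U"
    by (rule frame_at)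
  then show ?thesis
    using frame_span subspace_span by metis
qed

lemmas fibre_closed =
  subspace_0[OF subspace_fibre] subspace_add[OF subspace_fibre] subspace_scale[OF subspace_fibre]
  subspace_sum[OF subspace_fibre]

lemma dual_fibre_0:
  assumes "\<alpha> \<in> dual_fibre A x"
  shows "\<alpha> 0 = 0"
proof -
  have "\<alpha> (0 *\<^sub>R 0) = 0 * \<alpha> 0"
    using assms fibre_closed(1) unfolding dual_fibre_def by blast
  then show ?thesis
    by simp
qed

lemma dual_fibre_sum:
  assumes "\<alpha> \<in> dual_fibre A x" "\<And>i. i \<in> I \<Longrightarrow> b i \<in> fibre A x"
  shows "\<alpha> (\<Sum>i\<in>I. c i *\<^sub>R b i) = (\<Sum>i\<in>I. c i * \<alpha> (b i))"
  using assms(2)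
proof (induction I rule: infinite_finite_induct)
  case (insert i I)
  have "(\<Sum>i\<in>I. c i *\<^sub>R b i) \<in> fibre A x" "c i *\<^sub>R b i \<in> fibre A x"
    using insert.prems by (auto intro!: fibre_closed)
  then show ?case
    using insert assms(1) by (simp add: dual_fibre_def)
qed (simp_all add: dual_fibre_0[OF assms(1)])

text \<open>A vector is determined by its coordinates in a frame, and the coordinate functionals are
  themselves covectors. This gives the uniqueness behind the \<open>THE\<close> in
  \<open>sharp\<close>.\<close>

lemma dual_fibre_separates:
  assumes "v \<in> fibre A x" "w \<in> fibre A x" "\<And>\<beta>. \<beta> \<in> dual_fibre A x \<Longrightarrow> \<beta> v = \<beta> w"
  shows "v = w"
proof -
  obtain U e where e: "(U, e) \<in> frames A" "x \<in> U"
    by (rule frame_at)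
  define B where "B = (\<lambda>i. e i x) ` {..<rank A}"
  have B: "independent B" "span B = fibre A x" "finite B"
    using frame_independent[OF e] frame_span[OF e] by (auto simp: B_def)
  have coord: "representation B v b = representation B w b" for b
  proof -
    \<comment> \<open>The coordinate functional belonging to \<open>b\<close>, cut off outside the
      fibre as \<open>dual_fibre\<close> demands.\<close>
    have "(\<lambda>u. if u \<in> fibre A x then representation B u b else 0) \<in> dual_fibre A x"
      using B by (auto simp: dual_fibre_def representation_add representation_scale fibre_closed)
    from assms(3)[OF this] show ?thesis
      using assms(1,2) by simp
  qed
  have repr: "(\<Sum>b\<in>B. representation B u b *\<^sub>R b) = u" if "u \<in> fibre A x" for u
    using that B by (intro sum_representation_eq) auto
  show ?thesis
    by (rule trans[OF repr[OF assms(1), symmetric, unfolded coord] repr[OF assms(2)]])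
qed

section \<open>The flat map of a 2-form\<close>

lemma two_formD:
  assumes "two_form A \<omega>" "u \<in> fibre A x" "w \<in> fibre A x"
  shows "v \<in> fibre A x \<Longrightarrow> \<omega> x (u + v) w = \<omega> x u w + \<omega> x v w"
    and "\<omega> x (c *\<^sub>R u) w = c * \<omega> x u w"
    and "\<omega> x u w = - \<omega> x w u"
  using assms unfolding two_form_def by blast+

text \<open>\<open>two_form\<close> states linearity in the first argument, while a covector must be
  linear in the second; skew-symmetry carries it over.\<close>

lemma flat_mem:
  assumes \<omega>: "two_form A \<omega>" and v: "v \<in> fibre A x"
  shows "flat A \<omega> x v \<in> dual_fibre A x"
proof -
  note add = two_formD(1)[OF \<omega>] and scale = two_formD(2)[OF \<omega>] and skew = two_formD(3)[OF \<omega>]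
  have "\<omega> x v (u + w) = \<omega> x v u + \<omega> x v w" if "u \<in> fibre A x" "w \<in> fibre A x" for u w
    using that v add[of u x v w] skew[of u x v] skew[of w x v] skew[of "u + w" x v] fibre_closed(2)
    by simp
  moreover have "\<omega> x v (c *\<^sub>R u) = c * \<omega> x v u" if "u \<in> fibre A x" for u c
    using that v scale[of u x v c] skew[of u x v] skew[of "c *\<^sub>R u" x v] fibre_closed(3) by simp
  ultimately show ?thesis
    by (auto simp: dual_fibre_def flat_def fibre_closed)
qed

lemma flat_add:
  assumes "two_form A \<omega>" "u \<in> fibre A x" "v \<in> fibre A x"
  shows "flat A \<omega> x (u + v) = (\<lambda>w. flat A \<omega> x u w + flat A \<omega> x v w)"
  using two_formD(1)[OF assms(1,2)] assms(3) by (auto simp: flat_def)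

lemma flat_scale:
  assumes "two_form A \<omega>" "v \<in> fibre A x"
  shows "flat A \<omega> x (c *\<^sub>R v) = (\<lambda>w. c * flat A \<omega> x v w)"
  using two_formD(2)[OF assms] by (auto simp: flat_def)

lemma flat_skew:
  assumes "two_form A \<omega>" "v \<in> fibre A x" "w \<in> fibre A x"
  shows "flat A \<omega> x v w = - flat A \<omega> x w v"
  using two_formD(3)[OF assms] assms(2,3) by (simp add: flat_def)

section \<open>The sharp map of a bivector\<close>

lemma sharp_eqI:
  assumes "v \<in> fibre A x" "\<And>\<beta>. \<beta> \<in> dual_fibre A x \<Longrightarrow> \<beta> v = \<pi> x \<alpha> \<beta>"
  shows "sharp A \<pi> x \<alpha> = v"
  unfolding sharp_def
proof (rule the_equality)
  \<comment> \<open>Two candidates have equal pairings with all covectors, so separation identifies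
    them.\<close>
  show "w = v" if "w \<in> fibre A x \<and> (\<forall>\<beta>\<in>dual_fibre A x. \<beta> w = \<pi> x \<alpha> \<beta>)" for w
    using that assms by (intro dual_fibre_separates[of w x v]) auto
qed (simp add: assms)

text \<open>Contracting the coefficient matrix with \<open>\<alpha>\<close> in its first index
  yields a vector with the required pairings. The formula serves twice: it exhibits a witness for
  the \<open>THE\<close> in \<open>sharp\<close>, and its components show the smoothness of the
  sharp map.\<close>

lemma sharp_frame:
  assumes "(U, e) \<in> frames A" "x \<in> U" "\<alpha> \<in> dual_fibre A x"
    and "\<And>\<beta>. \<beta> \<in> dual_fibre A x \<Longrightarrow>
           \<pi> x \<alpha> \<beta> = (\<Sum>i<rank A. \<Sum>j<rank A. c i j x * \<alpha> (e i x) * \<beta> (e j x))"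
  shows "sharp A \<pi> x \<alpha> = (\<Sum>j<rank A. (\<Sum>i<rank A. c i j x * \<alpha> (e i x)) *\<^sub>R e j x)"
proof (rule sharp_eqI)
  show "(\<Sum>j<rank A. (\<Sum>i<rank A. c i j x * \<alpha> (e i x)) *\<^sub>R e j x) \<in> fibre A x"
    using frame_mem[OF assms(1,2)] by (auto intro!: fibre_closed)
  fix \<beta> assume \<beta>: "\<beta> \<in> dual_fibre A x"
  have "\<beta> (\<Sum>j<rank A. (\<Sum>i<rank A. c i j x * \<alpha> (e i x)) *\<^sub>R e j x)
      = (\<Sum>j<rank A. (\<Sum>i<rank A. c i j x * \<alpha> (e i x)) * \<beta> (e j x))"
    using frame_mem[OF assms(1,2)] by (intro dual_fibre_sum[OF \<beta>]) auto
  also have "\<dots> = \<pi> x \<alpha> \<beta>"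
    unfolding assms(4)[OF \<beta>] sum_distrib_right by (rule sum.swap)
  finally show "\<beta> (\<Sum>j<rank A. (\<Sum>i<rank A. c i j x * \<alpha> (e i x)) *\<^sub>R e j x) = \<pi> x \<alpha> \<beta>" .
qed

lemma bivector_frame:
  assumes "bivector A \<pi>" "(U, e) \<in> frames A"
  obtains c where "\<And>i j. i < rank A \<Longrightarrow> j < rank A \<Longrightarrow> smooth_fun_on (atlas A) U (c i j)"
    and "\<And>x \<alpha> \<beta>. x \<in> U \<Longrightarrow> \<alpha> \<in> dual_fibre A x \<Longrightarrow> \<beta> \<in> dual_fibre A x \<Longrightarrow>
           \<pi> x \<alpha> \<beta> = (\<Sum>i<rank A. \<Sum>j<rank A. c i j x * \<alpha> (e i x) * \<beta> (e j x))"
proof -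
  have "\<forall>(U, e)\<in>frames A. \<exists>c.
        (\<forall>i<rank A. \<forall>j<rank A. smooth_fun_on (atlas A) U (c i j)) \<and>
        (\<forall>x\<in>U. \<forall>\<alpha>\<in>dual_fibre A x. \<forall>\<beta>\<in>dual_fibre A x.
           \<pi> x \<alpha> \<beta> = (\<Sum>i<rank A. \<Sum>j<rank A. c i j x * \<alpha> (e i x) * \<beta> (e j x)))"
    using assms(1) unfolding bivector_def by (elim conjE)
  from bspec[OF this assms(2)] show thesis
    unfolding case_prod_conv
  proof (elim exE conjE)
    fix c
    assume "\<forall>i<rank A. \<forall>j<rank A. smooth_fun_on (atlas A) U (c i j)"
      and "\<forall>x\<in>U. \<forall>\<alpha>\<in>dual_fibre A x. \<forall>\<beta>\<in>dual_fibre A x.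
             \<pi> x \<alpha> \<beta> = (\<Sum>i<rank A. \<Sum>j<rank A. c i j x * \<alpha> (e i x) * \<beta> (e j x))"
    then show thesis
      by (intro that[of c]) blast+
  qed
qed

lemma bivectorD:
  assumes "bivector A \<pi>" "\<alpha> \<in> dual_fibre A x" "\<gamma> \<in> dual_fibre A x"
  shows "\<beta> \<in> dual_fibre A x \<Longrightarrow> \<pi> x (\<lambda>v. \<alpha> v + \<beta> v) \<gamma> = \<pi> x \<alpha> \<gamma> + \<pi> x \<beta> \<gamma>"
    and "\<pi> x (\<lambda>v. c * \<alpha> v) \<gamma> = c * \<pi> x \<alpha> \<gamma>"
    and "\<pi> x \<alpha> \<gamma> = - \<pi> x \<gamma> \<alpha>"
proof -
  note D = assms(1)[unfolded bivector_def]
  show "\<pi> x (\<lambda>v. \<alpha> v + \<beta> v) \<gamma> = \<pi> x \<alpha> \<gamma> + \<pi> x \<beta> \<gamma>" if "\<beta> \<in> dual_fibre A x"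
    using D[THEN conjunct1] assms(2,3) that by fast
  show "\<pi> x (\<lambda>v. c * \<alpha> v) \<gamma> = c * \<pi> x \<alpha> \<gamma>"
    using D[THEN conjunct2, THEN conjunct1] assms(2,3) by fast
  show "\<pi> x \<alpha> \<gamma> = - \<pi> x \<gamma> \<alpha>"
    using D[THEN conjunct2, THEN conjunct2, THEN conjunct1] assms(2,3) by fast
qed

text \<open>Both facts rest on the existence of the vector described by \<open>THE\<close>; the
  expansion of \<open>\<pi>\<close> in one frame around \<open>x\<close> provides it.\<close>

lemma
  assumes "bivector A \<pi>" "\<alpha> \<in> dual_fibre A x"
  shows sharp_mem: "sharp A \<pi> x \<alpha> \<in> fibre A x"
    and sharp_eval: "\<And>\<beta>. \<beta> \<in> dual_fibre A x \<Longrightarrow> \<beta> (sharp A \<pi> x \<alpha>) = \<pi> x \<alpha> \<beta>"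
proof -
  obtain U e where e: "(U, e) \<in> frames A" "x \<in> U"
    by (rule frame_at)
  obtain c where "\<And>i j. i < rank A \<Longrightarrow> j < rank A \<Longrightarrow> smooth_fun_on (atlas A) U (c i j)"
    and c: "\<And>x \<alpha> \<beta>. x \<in> U \<Longrightarrow> \<alpha> \<in> dual_fibre A x \<Longrightarrow> \<beta> \<in> dual_fibre A x \<Longrightarrow>
      \<pi> x \<alpha> \<beta> = (\<Sum>i<rank A. \<Sum>j<rank A. c i j x * \<alpha> (e i x) * \<beta> (e j x))"
    by (fact bivector_frame[OF assms(1) e(1)])
  have eq: "sharp A \<pi> x \<alpha> = (\<Sum>j<rank A. (\<Sum>i<rank A. c i j x * \<alpha> (e i x)) *\<^sub>R e j x)"
    using c[OF e(2) assms(2)] by (intro sharp_frame[OF e assms(2)])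
  show "sharp A \<pi> x \<alpha> \<in> fibre A x"
    unfolding eq using frame_mem[OF e] by (auto intro!: fibre_closed)
  fix \<beta> assume \<beta>: "\<beta> \<in> dual_fibre A x"
  have "\<beta> (sharp A \<pi> x \<alpha>) = (\<Sum>j<rank A. (\<Sum>i<rank A. c i j x * \<alpha> (e i x)) * \<beta> (e j x))"
    unfolding eq using frame_mem[OF e] by (intro dual_fibre_sum[OF \<beta>]) auto
  also have "\<dots> = \<pi> x \<alpha> \<beta>"
    unfolding c[OF e(2) assms(2) \<beta>] sum_distrib_right by (rule sum.swap)
  finally show "\<beta> (sharp A \<pi> x \<alpha>) = \<pi> x \<alpha> \<beta>" .
qed

lemma sharp_add:
  assumes "bivector A \<pi>" "\<alpha> \<in> dual_fibre A x" "\<beta> \<in> dual_fibre A x"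
  shows "sharp A \<pi> x (\<lambda>v. \<alpha> v + \<beta> v) = sharp A \<pi> x \<alpha> + sharp A \<pi> x \<beta>"
proof (rule sharp_eqI)
  show "sharp A \<pi> x \<alpha> + sharp A \<pi> x \<beta> \<in> fibre A x"
    using assms by (intro fibre_closed sharp_mem)
  fix \<gamma> assume \<gamma>: "\<gamma> \<in> dual_fibre A x"
  have "\<pi> x (\<lambda>v. \<alpha> v + \<beta> v) \<gamma> = \<pi> x \<alpha> \<gamma> + \<pi> x \<beta> \<gamma>"
    using assms \<gamma> by (intro bivectorD(1))
  moreover have "\<gamma> (sharp A \<pi> x \<alpha> + sharp A \<pi> x \<beta>) = \<gamma> (sharp A \<pi> x \<alpha>) + \<gamma> (sharp A \<pi> x \<beta>)"
    using sharp_mem assms \<gamma> by (simp add: dual_fibre_def)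
  ultimately show "\<gamma> (sharp A \<pi> x \<alpha> + sharp A \<pi> x \<beta>) = \<pi> x (\<lambda>v. \<alpha> v + \<beta> v) \<gamma>"
    using assms \<gamma> by (simp only: sharp_eval)
qed

lemma sharp_scale:
  assumes "bivector A \<pi>" "\<alpha> \<in> dual_fibre A x"
  shows "sharp A \<pi> x (\<lambda>v. c * \<alpha> v) = c *\<^sub>R sharp A \<pi> x \<alpha>"
proof (rule sharp_eqI)
  show "c *\<^sub>R sharp A \<pi> x \<alpha> \<in> fibre A x"
    using assms by (intro fibre_closed sharp_mem)
  fix \<gamma> assume \<gamma>: "\<gamma> \<in> dual_fibre A x"
  have "\<pi> x (\<lambda>v. c * \<alpha> v) \<gamma> = c * \<pi> x \<alpha> \<gamma>"
    using assms \<gamma> by (intro bivectorD(2))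
  moreover have "\<gamma> (c *\<^sub>R sharp A \<pi> x \<alpha>) = c * \<gamma> (sharp A \<pi> x \<alpha>)"
    using sharp_mem assms \<gamma> by (simp add: dual_fibre_def)
  ultimately show "\<gamma> (c *\<^sub>R sharp A \<pi> x \<alpha>) = \<pi> x (\<lambda>v. c * \<alpha> v) \<gamma>"
    using assms \<gamma> by (simp only: sharp_eval)
qed

text \<open>Skew-symmetry of \<open>\<pi>\<close> read through the pairing; it later moves a sharp
  from one argument of a form to the other.\<close>

lemma sharp_skew:
  assumes "bivector A \<pi>" "\<alpha> \<in> dual_fibre A x" "\<beta> \<in> dual_fibre A x"
  shows "\<beta> (sharp A \<pi> x \<alpha>) = - \<alpha> (sharp A \<pi> x \<beta>)"
proof -
  have "\<pi> x \<alpha> \<beta> = - \<pi> x \<beta> \<alpha>"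
    using assms by (intro bivectorD(3))
  then show ?thesis
    using assms by (simp only: sharp_eval)
qed

section \<open>Smoothness of the musical maps in a local frame\<close>

lemma flat_smooth:
  assumes \<omega>: "two_form A \<omega>" and e: "(U, e) \<in> frames A"
    and s: "smooth_combination_on A e U s" and k: "k < rank A"
  shows "smooth_fun_on (atlas A) U (\<lambda>x. flat A \<omega> x (s x) (e k x))"
proof -
  note smooth = smooth_manifold_atlas frame_open[OF e]
  obtain c where c: "\<And>i. i < rank A \<Longrightarrow> smooth_fun_on (atlas A) U (c i)"
    and s_eq: "\<And>x. x \<in> U \<Longrightarrow> s x = (\<Sum>i<rank A. c i x *\<^sub>R e i x)"
    using s unfolding smooth_combination_on_def by auto
  have \<omega>_smooth: "smooth_fun_on (atlas A) U (\<lambda>x. \<omega> x (e i x) (e k x))" if "i < rank A" for i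
    using \<omega>[unfolded two_form_def, THEN conjunct2, THEN conjunct2, THEN conjunct2] e k that
    by fast
  show ?thesis
  proof (rule smooth_fun_on_cong[OF smooth])
    show "smooth_fun_on (atlas A) U (\<lambda>x. \<Sum>i<rank A. c i x * \<omega> x (e i x) (e k x))"
      using c \<omega>_smooth
      by (intro smooth_fun_on_sum[OF smooth] smooth_fun_on_mult[OF smooth]) auto
    fix x assume x: "x \<in> U"
    note mem = frame_mem[OF e x]
    have sx: "s x \<in> fibre A x"
      using mem by (auto simp: s_eq[OF x] intro!: fibre_closed)
    \<comment> \<open>The expansion of \<open>s x\<close> stands in the first slot; skew-symmetry
      moves it to the second, where linearity of the covector
      \<open>flat A \<omega> x (e k x)\<close> applies. A second use of skew-symmetry, term by term,
      restores the sign.\<close>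
    have "flat A \<omega> x (s x) (e k x) = - flat A \<omega> x (e k x) (\<Sum>i<rank A. c i x *\<^sub>R e i x)"
      using flat_skew[OF \<omega> sx mem[OF k]] s_eq[OF x] by simp
    also have "\<dots> = - (\<Sum>i<rank A. c i x * flat A \<omega> x (e k x) (e i x))"
      using mem k by (subst dual_fibre_sum[OF flat_mem[OF \<omega>]]) auto
    also have "\<dots> = (\<Sum>i<rank A. c i x * \<omega> x (e i x) (e k x))"
      unfolding sum_negf[symmetric]
    proof (intro sum.cong refl)
      fix i assume "i \<in> {..<rank A}"
      then have "flat A \<omega> x (e k x) (e i x) = - \<omega> x (e i x) (e k x)"
        using flat_skew[OF \<omega> mem[OF k] mem[of i]] mem k by (simp add: flat_def)
      then show "- (c i x * flat A \<omega> x (e k x) (e i x)) = c i x * \<omega> x (e i x) (e k x)"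
        by simp
    qed
    finally show "(\<Sum>i<rank A. c i x * \<omega> x (e i x) (e k x)) = flat A \<omega> x (s x) (e k x)" ..
  qed
qed

text \<open>By \<open>sharp_frame\<close> the components are sums of products of smooth coefficients
  of \<open>\<pi>\<close> with the functions \<open>\<alpha> x (e i x)\<close>. The assumptions on
  \<open>\<alpha>\<close> are local to \<open>U\<close>, so each frame can be treated
  separately.\<close>

lemma sharp_smooth:
  assumes \<pi>: "bivector A \<pi>" and e: "(U, e) \<in> frames A"
    and \<alpha>: "\<And>x. x \<in> U \<Longrightarrow> \<alpha> x \<in> dual_fibre A x"
    and \<alpha>_smooth: "\<And>i. i < rank A \<Longrightarrow> smooth_fun_on (atlas A) U (\<lambda>x. \<alpha> x (e i x))"
  shows "smooth_combination_on A e U (\<lambda>x. sharp A \<pi> x (\<alpha> x))"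
proof -
  note smooth = smooth_manifold_atlas frame_open[OF e]
  obtain c where c: "\<And>i j. i < rank A \<Longrightarrow> j < rank A \<Longrightarrow> smooth_fun_on (atlas A) U (c i j)"
    and \<pi>_eq: "\<And>x \<alpha> \<beta>. x \<in> U \<Longrightarrow> \<alpha> \<in> dual_fibre A x \<Longrightarrow> \<beta> \<in> dual_fibre A x \<Longrightarrow>
      \<pi> x \<alpha> \<beta> = (\<Sum>i<rank A. \<Sum>j<rank A. c i j x * \<alpha> (e i x) * \<beta> (e j x))"
    by (fact bivector_frame[OF \<pi> e])
  have "smooth_fun_on (atlas A) U (\<lambda>x. \<Sum>i<rank A. c i j x * \<alpha> x (e i x))" if "j < rank A" for j
    using c \<alpha>_smooth that
    by (intro smooth_fun_on_sum[OF smooth] smooth_fun_on_mult[OF smooth]) auto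
  moreover have "sharp A \<pi> x (\<alpha> x) = (\<Sum>j<rank A. (\<Sum>i<rank A. c i j x * \<alpha> x (e i x)) *\<^sub>R e j x)"
    if "x \<in> U" for x
    using \<pi>_eq[OF that \<alpha>[OF that]] by (intro sharp_frame[OF e that \<alpha>[OF that]])
  ultimately show ?thesis
    unfolding smooth_combination_on_def
    by (intro exI[of _ "\<lambda>j x. \<Sum>i<rank A. c i j x * \<alpha> x (e i x)"]) auto
qed

end

section \<open>The metric\<close>

theorem proposition6p3:
  fixes A :: "('m::{t2_space, second_countable_topology}, 'e::real_normed_vector, 'v::real_vector)
                lie_algebroid"
    and \<epsilon> :: "3 \<Rightarrow> real"
    and \<omega> :: "3 \<Rightarrow> 'm \<Rightarrow> 'v \<Rightarrow> 'v \<Rightarrow> real"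
    and \<pi> :: "3 \<Rightarrow> 'm \<Rightarrow> ('v \<Rightarrow> real) \<Rightarrow> ('v \<Rightarrow> real) \<Rightarrow> real"
  assumes "lie_algebroid A"
    and "hypersymplectic A \<epsilon> \<omega> \<pi> \<or> para_hypersymplectic A \<epsilon> \<omega> \<pi>"
  shows "pseudo_metric A (g_flat A \<epsilon> \<omega> \<pi>)"
proof -
  have vb: "vector_bundle A"
    using assms(1) by (simp add: lie_algebroid_def)
  have eps: "eps_hypersymplectic A \<epsilon> \<omega> \<pi>" and eps_prod: "\<epsilon> 1 * \<epsilon> 2 * \<epsilon> 3 = - 1"
    using assms(2) by (auto simp: hypersymplectic_def para_hypersymplectic_def)
  have \<omega>: "two_form A (\<omega> i)" and \<omega>_nondeg: "nondegenerate A (flat A (\<omega> i))"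
    and \<pi>: "bivector A (\<pi> i)" for i
    using eps by (auto simp: eps_hypersymplectic_def symplectic_def inverse_bivector_def)
  have flat_sharp: "\<alpha> \<in> dual_fibre A x \<Longrightarrow> flat A (\<omega> i) x (sharp A (\<pi> i) x \<alpha>) = \<alpha>"
    and sharp_flat: "v \<in> fibre A x \<Longrightarrow> sharp A (\<pi> i) x (flat A (\<omega> i) x v) = v" for i x \<alpha> v
    using eps by (auto simp: eps_hypersymplectic_def inverse_bivector_def)
  note flat_mem = flat_mem[OF vb \<omega>] and sharp_mem = sharp_mem[OF vb \<pi>]
  note closed = fibre_closed[OF vb]

  \<comment> \<open>The composites of a sharp with a flat and their relations\<close>
  define P where "P i j x v = sharp A (\<pi> i) x (flat A (\<omega> j) x v)" for i j x v
  have P_mem: "P i j x v \<in> fibre A x" if "v \<in> fibre A x" for i j x v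
    using that by (simp add: P_def flat_mem sharp_mem)
  have P_comp: "P i j x (P j k x v) = P i k x v" if "v \<in> fibre A x" for i j k x v
    using that by (simp add: P_def flat_sharp flat_mem)
  have P_id: "P i i x v = v" if "v \<in> fibre A x" for i x v
    using that by (simp add: P_def sharp_flat)
  have P_add: "P i j x (u + v) = P i j x u + P i j x v"
    if "u \<in> fibre A x" "v \<in> fibre A x" for i j x u v
    using that by (simp add: P_def flat_add[OF vb \<omega>] sharp_add[OF vb \<pi>] flat_mem)
  have P_scale: "P i j x (c *\<^sub>R v) = c *\<^sub>R P i j x v" if "v \<in> fibre A x" for i j x c v
    using that by (simp add: P_def flat_scale[OF vb \<omega>] sharp_scale[OF vb \<pi>] flat_mem)
  have flat_P: "flat A (\<omega> i) x (P i j x v) = flat A (\<omega> j) x v" if "v \<in> fibre A x" for i j x v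
    using that by (simp add: P_def flat_sharp flat_mem)
  \<comment> \<open>Three sign changes, from the skew-symmetry of \<open>\<omega> i\<close>,
    \<open>\<pi> j\<close> and \<open>\<omega> k\<close> in turn, leave one minus sign.\<close>
  have adjoint: "flat A (\<omega> i) x (P j k x w) v = - flat A (\<omega> k) x (P j i x v) w"
    if "v \<in> fibre A x" "w \<in> fibre A x" for i j k x v w
  proof -
    have "flat A (\<omega> i) x (P j k x w) v = - flat A (\<omega> i) x v (P j k x w)"
      using that by (intro flat_skew[OF vb \<omega>] P_mem)
    also have "\<dots> = flat A (\<omega> k) x w (P j i x v)"
      using sharp_skew[OF vb \<pi>[of j] flat_mem[OF that(2), of k] flat_mem[OF that(1), of i]]
      by (simp add: P_def)
    also have "\<dots> = - flat A (\<omega> k) x (P j i x v) w"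
      using that by (intro flat_skew[OF vb \<omega>] P_mem)
    finally show ?thesis .
  qed
  \<comment> \<open>\<open>P i j\<close> is inverse to \<open>P j i\<close>, so applying it to the
    hypothesis on the square removes one factor on the left.\<close>
  have swap: "P j i x v = c *\<^sub>R P i j x v"
    if "\<And>v. v \<in> fibre A x \<Longrightarrow> P j i x (P j i x v) = c *\<^sub>R v" "v \<in> fibre A x" for i j x v c
  proof -
    have "P j i x v = P i j x (P j i x (P j i x v))"
      using that(2) by (simp add: P_comp P_id P_mem)
    also have "\<dots> = c *\<^sub>R P i j x v"
      using that by (simp only: P_scale)
    finally show ?thesis .
  qed
  have tt: "P (i - 1) (i + 1) x (P (i - 1) (i + 1) x v) = \<epsilon> i *\<^sub>R v" if "v \<in> fibre A x" for i x v
    using eps that by (simp add: eps_hypersymplectic_def transition_tensor_def P_def)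
  \<comment> \<open>Arithmetic modulo 3, with 0 written as 3: it identifies the transition tensors
    for i = 1, 2, 3 as \<open>P 3 2\<close>, \<open>P 1 3\<close> and \<open>P 2 1\<close>.\<close>
  have Z3: "(1::3) - 1 = 3" "(1::3) + 1 = 2" "(2::3) - 1 = 1" "(2::3) + 1 = 3" "(3::3) - 1 = 2"
    "(3::3) + 1 = 1"
    by simp_all
  have P32: "P 3 2 x v = \<epsilon> 1 *\<^sub>R P 2 3 x v" and P13: "P 1 3 x v = \<epsilon> 2 *\<^sub>R P 3 1 x v"
    and P21: "P 2 1 x v = \<epsilon> 3 *\<^sub>R P 1 2 x v" if "v \<in> fibre A x" for x v
    using that tt[where i = 1, unfolded Z3] tt[where i = 2, unfolded Z3]
      tt[where i = 3, unfolded Z3] by (auto intro: swap)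
  have g: "g_flat A \<epsilon> \<omega> \<pi> x v = (\<lambda>w. \<epsilon> 3 * \<epsilon> 2 * flat A (\<omega> 3) x (P 1 2 x v) w)" for x v
    by (simp add: g_flat_def P_def)

  \<comment> \<open>The defining properties of the pseudo-metric\<close>
  have g_mem: "g_flat A \<epsilon> \<omega> \<pi> x v \<in> dual_fibre A x" if "v \<in> fibre A x" for x v
    using flat_mem[OF P_mem[OF that]] unfolding g by (simp add: dual_fibre_def algebra_simps)
  have g_add: "g_flat A \<epsilon> \<omega> \<pi> x (u + v) = (\<lambda>w. g_flat A \<epsilon> \<omega> \<pi> x u w + g_flat A \<epsilon> \<omega> \<pi> x v w)"
    if "u \<in> fibre A x" "v \<in> fibre A x" for x u v
    using that by (simp add: g P_add flat_add[OF vb \<omega>] P_mem algebra_simps)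
  have g_scale: "g_flat A \<epsilon> \<omega> \<pi> x (c *\<^sub>R v) = (\<lambda>w. c * g_flat A \<epsilon> \<omega> \<pi> x v w)"
    if "v \<in> fibre A x" for x c v
    using that by (simp add: g P_scale flat_scale[OF vb \<omega>] P_mem algebra_simps)

  have g_sym: "g_flat A \<epsilon> \<omega> \<pi> x v w = g_flat A \<epsilon> \<omega> \<pi> x w v"
    if v: "v \<in> fibre A x" and w: "w \<in> fibre A x" for x v w
  proof -
    \<comment> \<open>The indices of \<open>P 3 2\<close> and \<open>P 1 3\<close> do not match for
      composition; after replacing both by multiples of their inverses they do, since
      \<open>P 2 3\<close> after \<open>P 3 1\<close> is \<open>P 2 1\<close>.\<close>
    have "P 3 2 x (P 1 3 x v) = (\<epsilon> 1 * \<epsilon> 2) *\<^sub>R P 2 1 x v"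
      using v by (simp add: P32 P13 P_mem P_scale P_comp closed)
    also have "\<dots> = (\<epsilon> 1 * \<epsilon> 2 * \<epsilon> 3) *\<^sub>R P 1 2 x v"
      using v by (simp add: P21)
    finally have "P 3 2 x (P 1 3 x v) = (- 1) *\<^sub>R P 1 2 x v"
      using eps_prod by simp
    moreover have "flat A (\<omega> 3) x (P 1 2 x w) v = - flat A (\<omega> 3) x (P 3 2 x (P 1 3 x v)) w"
      using adjoint[OF v w] by (simp only: flat_P P_mem v)
    ultimately have "flat A (\<omega> 3) x (P 1 2 x w) v = flat A (\<omega> 3) x (P 1 2 x v) w"
      using v by (simp only: flat_scale[OF vb \<omega> P_mem])
    then show ?thesis
      by (simp add: g)
  qed

  have g_nondeg: "nondegenerate A (g_flat A \<epsilon> \<omega> \<pi>)"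
    unfolding nondegenerate_def
  proof (intro allI ballI impI)
    fix x v assume v: "v \<in> fibre A x" and "\<forall>w\<in>fibre A x. g_flat A \<epsilon> \<omega> \<pi> x v w = 0"
    \<comment> \<open>Both signs are factors of the product -1, so the scalar in front of the metric
      can be cancelled.\<close>
    moreover have "\<epsilon> 3 * \<epsilon> 2 \<noteq> 0"
      using eps_prod by auto
    ultimately have "\<forall>w\<in>fibre A x. flat A (\<omega> 3) x (P 1 2 x v) w = 0"
      by (simp add: g)
    then have "P 1 2 x v = 0"
      using \<omega>_nondeg[of 3] P_mem[OF v] unfolding nondegenerate_def by blast
    \<comment> \<open>Non-degeneracy of \<open>\<omega> 3\<close> has removed the outer flat; what
      remains, \<open>P 1 2\<close>, is injective because \<open>P 2 1\<close> is a left
      inverse.\<close>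
    then have "v = P 2 1 x 0"
      using P_comp[OF v, of 2 1 2] P_id[OF v] by simp
    \<comment> \<open>Homogeneity with scalar 0 shows that \<open>P 2 1\<close> maps 0 to 0.\<close>
    also have "\<dots> = 0"
      using P_scale[OF v, of 2 1 0] by simp
    finally show "v = 0" .
  qed

  have g_smooth: "on_sections (g_flat A \<epsilon> \<omega> \<pi>) X \<in> dual_sections A" if X: "X \<in> sections A" for X
  proof -
    have "smooth_fun_on (atlas A) U (\<lambda>x. g_flat A \<epsilon> \<omega> \<pi> x (X x) (e k x))"
      if e: "(U, e) \<in> frames A" and k: "k < rank A" for U e k
    proof -
      \<comment> \<open>Smoothness is followed through the three factors: a flat and a sharp turn
        smooth components of \<open>X\<close> into smooth components of
        \<open>P 1 2 x (X x)\<close>, and the outer flat turns these into smooth values on the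
        frame.\<close>
      have "smooth_combination_on A e U X"
        using X e unfolding sections_def by blast
      then have "smooth_combination_on A e U (\<lambda>x. P 1 2 x (X x))"
        unfolding P_def using X
        by (intro sharp_smooth[OF vb \<pi> e] flat_smooth[OF vb \<omega> e] flat_mem)
          (auto simp: sections_def)
      then show ?thesis
        unfolding g using k
        by (intro smooth_fun_on_mult smooth_fun_on_const flat_smooth[OF vb \<omega> e]
            smooth_manifold_atlas[OF vb] frame_open[OF vb e])
    qed
    then show ?thesis
      using X g_mem by (auto simp: dual_sections_def on_sections_def sections_def)
  qed
  have "smooth_linear_to_dual A (on_sections (g_flat A \<epsilon> \<omega> \<pi>))"
    using g_smooth g_add g_scale
    by (auto simp: smooth_linear_to_dual_def on_sections_def sections_def)
  then show ?thesis
    using g_mem g_add g_scale g_sym g_nondeg by (auto simp: pseudo_metric_def)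
qed

end
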